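(* Let $(M,\Pi)$ be a Poisson manifold equipped with a smooth $\mathbb{R}^+$-action $\Phi:\mathbb{R}^+\times M\to M$. Suppose there exists a constant $c\in\mathbb{R}\setminus\{0\}$ such that $(\Phi_s)_*\Pi=s^c\,\Pi$ for all $s\in\mathbb{R}^+$. Then the Poisson manifold is exact; that is, there exists a vector field $D\in\mathfrak{X}(M)$ such that $\mathcal{L}_D\Pi=-\Pi$.
   Context: $\mathbb{R}^+$ denotes the multiplicative group of positive real numbers, and $\Phi_s=\Phi(s,\cdot):M\to M$. A Poisson manifold $(M,\Pi)$ is a smooth manifold with a Poisson bivector field $\Pi$. $(\Phi_s)_*\Pi$ is the pushforward of the bivector: $((\Phi_s)_*\Pi)(\alpha,\beta)=\Pi(\Phi_s^*\alpha,\Phi_s^*\beta)$ for covectors $\alpha,\beta$ at $\Phi_s(x)$, where the right-hand side is evaluated at $x$. $\mathcal{L}_D$ is the Lie derivative, defined by $\mathcal{L}_D\Pi=\frac{d}{dt}\big|_{t=0}\varphi_t^*\Pi$ with $\varphi_t$ the flow of $D$ and $\varphi_t^*\Pi=(\varphi_t^{-1})_*\Pi$. *)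

theory Defs
  imports "HOL-Analysis.Analysis"
begin

section \<open>Smooth functions between normed spaces\<close>

text \<open>
  The iterated directional derivatives exist and are continuous. On open subsets of
  finite-dimensional spaces, the only case used below, this is the usual class \<open>C\<^sup>k\<close>.
\<close>

primrec Ck_on :: "nat \<Rightarrow> 'a::real_normed_vector set \<Rightarrow> ('a \<Rightarrow> 'b::real_normed_vector) \<Rightarrow> bool"
  where
    "Ck_on 0 S f \<longleftrightarrow> continuous_on S f"
  | "Ck_on (Suc k) S f \<longleftrightarrow>
       (\<forall>x\<in>S. f differentiable (at x)) \<and> (\<forall>v. Ck_on k S (\<lambda>x. frechet_derivative f (at x) v))"

definition smooth_on :: "'a::real_normed_vector set \<Rightarrow> ('a \<Rightarrow> 'b::real_normed_vector) \<Rightarrow> bool"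
  where "smooth_on S f \<longleftrightarrow> open S \<and> (\<forall>k. Ck_on k S f)"


section \<open>Smooth manifolds\<close>

text \<open>
  The underlying space is a Hausdorff, second countable type \<open>'m\<close>. The model space is a
  real inner product space \<open>'e\<close> that is required to be finite-dimensional; unlike the
  class \<open>euclidean_space\<close>, this does not exclude dimension 0.
  A chart is a pair of its domain and its coordinate map, the latter being meaningful
  on the domain only. Any atlas, maximal or not, determines the smooth structure.
\<close>

type_synonym ('m, 'e) chart = "'m set \<times> ('m \<Rightarrow> 'e)"

definition is_chart :: "('m::topological_space, 'e::real_inner) chart \<Rightarrow> bool"
  where "is_chart = (\<lambda>(U, \<kappa>).
    open U \<and> open (\<kappa> ` U) \<and> homeomorphism U (\<kappa> ` U) \<kappa> (inv_into U \<kappa>))"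

definition smooth_transition ::
    "('m, 'e::real_inner) chart \<Rightarrow> ('m, 'e) chart \<Rightarrow> bool"
  where "smooth_transition = (\<lambda>(U, \<kappa>) (V, \<eta>).
    smooth_on (\<kappa> ` (U \<inter> V)) (\<lambda>y. \<eta> (inv_into U \<kappa> y)))"

definition smooth_manifold ::
    "('m::{t2_space, second_countable_topology}, 'e::real_inner) chart set \<Rightarrow> bool"
  where "smooth_manifold A \<longleftrightarrow>
    (\<exists>B::'e set. finite B \<and> span B = UNIV) \<and>
    (\<forall>C\<in>A. is_chart C) \<and>
    (\<Union>C\<in>A. fst C) = UNIV \<and>
    (\<forall>C\<in>A. \<forall>C'\<in>A. smooth_transition C C')"

definition real_atlas :: "(real, real) chart set"
  where "real_atlas = {(UNIV, \<lambda>x. x)}"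

definition prod_atlas ::
    "('m, 'e) chart set \<Rightarrow> ('n, 'f) chart set \<Rightarrow> ('m \<times> 'n, 'e \<times> 'f) chart set"
  where "prod_atlas A B = {(U \<times> V, map_prod \<kappa> \<eta>) | U \<kappa> V \<eta>. (U, \<kappa>) \<in> A \<and> (V, \<eta>) \<in> B}"

text \<open>Smoothness of a map on an open subset \<open>W\<close>; its values outside \<open>W\<close> are irrelevant.\<close>

definition smooth_map_on ::
    "('m::topological_space, 'e::real_inner) chart set \<Rightarrow>
     ('n::topological_space, 'f::real_inner) chart set \<Rightarrow> 'm set \<Rightarrow> ('m \<Rightarrow> 'n) \<Rightarrow> bool"
  where "smooth_map_on A B W F \<longleftrightarrow>
    open W \<and> continuous_on W F \<and>
    (\<forall>(U, \<kappa>)\<in>A. \<forall>(V, \<eta>)\<in>B.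
       smooth_on (\<kappa> ` {x \<in> W \<inter> U. F x \<in> V}) (\<lambda>y. \<eta> (F (inv_into U \<kappa> y))))"

definition smooth_fun_on ::
    "('m::topological_space, 'e::real_inner) chart set \<Rightarrow> 'm set \<Rightarrow> ('m \<Rightarrow> real) \<Rightarrow> bool"
  where "smooth_fun_on A W f \<longleftrightarrow> smooth_map_on A real_atlas W f"

definition smooth_near ::
    "('m::topological_space, 'e::real_inner) chart set \<Rightarrow> 'm \<Rightarrow> ('m \<Rightarrow> real) \<Rightarrow> bool"
  where "smooth_near A p f \<longleftrightarrow> (\<exists>W. p \<in> W \<and> smooth_fun_on A W f)"


section \<open>Tangent vectors, covectors, vector fields and bivector fields\<close>

text \<open>
  Tangent vectors at \<open>p\<close> are the derivations of the algebra of germs at \<open>p\<close> of smooth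
  functions. As functionals on all functions, they are made unique by the value 0 on
  functions that are not smooth near \<open>p\<close>; likewise for covectors and non-tangent vectors.
\<close>

type_synonym 'm tvec = "('m \<Rightarrow> real) \<Rightarrow> real"
type_synonym 'm covec = "'m tvec \<Rightarrow> real"

definition tangent_space ::
    "('m::topological_space, 'e::real_inner) chart set \<Rightarrow> 'm \<Rightarrow> 'm tvec set"
  where "tangent_space A p = {v.
    (\<forall>f g a b. smooth_near A p f \<longrightarrow> smooth_near A p g \<longrightarrow>
       v (\<lambda>x. a * f x + b * g x) = a * v f + b * v g) \<and>
    (\<forall>f g. smooth_near A p f \<longrightarrow> smooth_near A p g \<longrightarrow>
       v (\<lambda>x. f x * g x) = f p * v g + g p * v f) \<and>
    (\<forall>f g. smooth_near A p f \<longrightarrow> smooth_near A p g \<longrightarrow>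
       (\<forall>\<^sub>F x in nhds p. f x = g x) \<longrightarrow> v f = v g) \<and>
    (\<forall>f. \<not> smooth_near A p f \<longrightarrow> v f = 0)}"

definition cotangent_space ::
    "('m::topological_space, 'e::real_inner) chart set \<Rightarrow> 'm \<Rightarrow> 'm covec set"
  where "cotangent_space A p = {\<alpha>.
    (\<forall>v\<in>tangent_space A p. \<forall>w\<in>tangent_space A p. \<forall>a b.
       \<alpha> (\<lambda>f. a * v f + b * w f) = a * \<alpha> v + b * \<alpha> w) \<and>
    (\<forall>v. v \<notin> tangent_space A p \<longrightarrow> \<alpha> v = 0)}"

definition differential ::
    "('m::topological_space, 'e::real_inner) chart set \<Rightarrow> ('m \<Rightarrow> real) \<Rightarrow> 'm \<Rightarrow> 'm covec"
  where "differential A f p = (\<lambda>v. if v \<in> tangent_space A p then v f else 0)"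

definition smooth_vector_field ::
    "('m::topological_space, 'e::real_inner) chart set \<Rightarrow> ('m \<Rightarrow> 'm tvec) \<Rightarrow> bool"
  where "smooth_vector_field A X \<longleftrightarrow>
    (\<forall>p. X p \<in> tangent_space A p) \<and>
    (\<forall>W f. smooth_fun_on A W f \<longrightarrow> smooth_fun_on A W (\<lambda>p. X p f))"

text \<open>A bivector at \<open>p\<close> is a skew-symmetric bilinear form on the cotangent space at \<open>p\<close>.\<close>

type_synonym 'm bivec_field = "'m \<Rightarrow> 'm covec \<Rightarrow> 'm covec \<Rightarrow> real"

definition smooth_bivector_field ::
    "('m::topological_space, 'e::real_inner) chart set \<Rightarrow> 'm bivec_field \<Rightarrow> bool"
  where "smooth_bivector_field A \<pi> \<longleftrightarrow>
    (\<forall>p. \<forall>\<alpha>\<in>cotangent_space A p. \<forall>\<beta>\<in>cotangent_space A p. \<pi> p \<alpha> \<beta> = - \<pi> p \<beta> \<alpha>) \<and>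
    (\<forall>p. \<forall>\<alpha>\<in>cotangent_space A p. \<forall>\<beta>\<in>cotangent_space A p. \<forall>\<gamma>\<in>cotangent_space A p. \<forall>a b.
       \<pi> p (\<lambda>v. a * \<alpha> v + b * \<beta> v) \<gamma> = a * \<pi> p \<alpha> \<gamma> + b * \<pi> p \<beta> \<gamma>) \<and>
    (\<forall>W f g. smooth_fun_on A W f \<longrightarrow> smooth_fun_on A W g \<longrightarrow>
       smooth_fun_on A W (\<lambda>p. \<pi> p (differential A f p) (differential A g p)))"

definition poisson_bracket ::
    "('m::topological_space, 'e::real_inner) chart set \<Rightarrow> 'm bivec_field \<Rightarrow>
     ('m \<Rightarrow> real) \<Rightarrow> ('m \<Rightarrow> real) \<Rightarrow> 'm \<Rightarrow> real"
  where "poisson_bracket A \<pi> f g = (\<lambda>p. \<pi> p (differential A f p) (differential A g p))"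

text \<open>
  The Jacobi identity for the bracket on smooth functions on the whole manifold is the
  vanishing of the Schouten bracket of \<open>\<pi>\<close> with itself.
\<close>

definition poisson_manifold ::
    "('m::{t2_space, second_countable_topology}, 'e::real_inner) chart set \<Rightarrow>
     'm bivec_field \<Rightarrow> bool"
  where "poisson_manifold A \<pi> \<longleftrightarrow>
    smooth_manifold A \<and> smooth_bivector_field A \<pi> \<and>
    (\<forall>f g h. smooth_fun_on A UNIV f \<longrightarrow> smooth_fun_on A UNIV g \<longrightarrow> smooth_fun_on A UNIV h \<longrightarrow>
       (\<forall>p. poisson_bracket A \<pi> f (poisson_bracket A \<pi> g h) p
          + poisson_bracket A \<pi> g (poisson_bracket A \<pi> h f) p
          + poisson_bracket A \<pi> h (poisson_bracket A \<pi> f g) p = 0))"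


section \<open>Pushforward and pullback\<close>

definition push_tvec ::
    "('m::topological_space, 'e::real_inner) chart set \<Rightarrow> ('m \<Rightarrow> 'm) \<Rightarrow> 'm \<Rightarrow> 'm tvec \<Rightarrow> 'm tvec"
  where "push_tvec A F x v = (\<lambda>f. if smooth_near A (F x) f then v (f \<circ> F) else 0)"

text \<open>The covector \<open>F\<^sup>*\<alpha>\<close> at \<open>x\<close>, for a covector \<open>\<alpha>\<close> at \<open>F x\<close>.\<close>

definition pull_covec ::
    "('m::topological_space, 'e::real_inner) chart set \<Rightarrow> ('m \<Rightarrow> 'm) \<Rightarrow> 'm \<Rightarrow> 'm covec \<Rightarrow> 'm covec"
  where "pull_covec A F x \<alpha> = (\<lambda>v. if v \<in> tangent_space A x then \<alpha> (push_tvec A F x v) else 0)"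

text \<open>
  Here \<open>F\<close> is a diffeomorphism from the open set \<open>U\<close> onto the open set \<open>F ` U\<close>. The results
  are bivector fields on \<open>F ` U\<close> and on \<open>U\<close>, respectively.
\<close>

definition push_bivector ::
    "('m::topological_space, 'e::real_inner) chart set \<Rightarrow> 'm set \<Rightarrow> ('m \<Rightarrow> 'm) \<Rightarrow>
     'm bivec_field \<Rightarrow> 'm bivec_field"
  where "push_bivector A U F \<pi> = (\<lambda>y \<alpha> \<beta>.
    let x = inv_into U F y in \<pi> x (pull_covec A F x \<alpha>) (pull_covec A F x \<beta>))"

definition pull_bivector ::
    "('m::topological_space, 'e::real_inner) chart set \<Rightarrow> 'm set \<Rightarrow> ('m \<Rightarrow> 'm) \<Rightarrow>
     'm bivec_field \<Rightarrow> 'm bivec_field"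
  where "pull_bivector A U F \<pi> = push_bivector A (F ` U) (inv_into U F) \<pi>"


section \<open>Flows and the Lie derivative\<close>

text \<open>The curve \<open>\<gamma>\<close> has velocity \<open>v\<close>, a tangent vector at \<open>\<gamma> t\<close>, at time \<open>t\<close>.\<close>

definition has_velocity ::
    "('m::topological_space, 'e::real_inner) chart set \<Rightarrow> (real \<Rightarrow> 'm) \<Rightarrow> real \<Rightarrow> 'm tvec \<Rightarrow> bool"
  where "has_velocity A \<gamma> t v \<longleftrightarrow>
    (\<forall>f. smooth_near A (\<gamma> t) f \<longrightarrow> ((\<lambda>s. f (\<gamma> s)) has_real_derivative v f) (at t))"

text \<open>
  A local flow of \<open>D\<close>: the domain \<open>W\<close> is an open neighbourhood of time 0 whose slices in the
  time direction are intervals. Any two flows of a smooth \<open>D\<close> agree on the intersection of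
  their domains, and each \<open>\<phi> t\<close> is a diffeomorphism from \<open>flow_slice W t\<close> onto an open set.
\<close>

definition is_flow ::
    "('m::topological_space, 'e::real_inner) chart set \<Rightarrow> ('m \<Rightarrow> 'm tvec) \<Rightarrow>
     (real \<times> 'm) set \<Rightarrow> (real \<Rightarrow> 'm \<Rightarrow> 'm) \<Rightarrow> bool"
  where "is_flow A D W \<phi> \<longleftrightarrow>
    (\<forall>x. (0, x) \<in> W \<and> is_interval {t. (t, x) \<in> W}) \<and>
    smooth_map_on (prod_atlas real_atlas A) A W (\<lambda>(t, x). \<phi> t x) \<and>
    (\<forall>x. \<phi> 0 x = x) \<and>
    (\<forall>(t, x)\<in>W. has_velocity A (\<lambda>s. \<phi> s x) t (D (\<phi> t x)))"

definition flow_slice :: "(real \<times> 'm) set \<Rightarrow> real \<Rightarrow> 'm set"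
  where "flow_slice W t = {x. (t, x) \<in> W}"

text \<open>
  \<open>\<Lambda>\<close> is the Lie derivative of \<open>\<pi>\<close> along \<open>D\<close>. A smooth vector field has a flow, and the
  derivative at time 0 does not depend on the flow that is used.
\<close>

definition has_lie_derivative ::
    "('m::topological_space, 'e::real_inner) chart set \<Rightarrow> ('m \<Rightarrow> 'm tvec) \<Rightarrow>
     'm bivec_field \<Rightarrow> 'm bivec_field \<Rightarrow> bool"
  where "has_lie_derivative A D \<pi> \<Lambda> \<longleftrightarrow>
    (\<exists>W \<phi>. is_flow A D W \<phi> \<and>
       (\<forall>p. \<forall>\<alpha>\<in>cotangent_space A p. \<forall>\<beta>\<in>cotangent_space A p.
          ((\<lambda>t. pull_bivector A (flow_slice W t) (\<phi> t) \<pi> p \<alpha> \<beta>)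
             has_real_derivative \<Lambda> p \<alpha> \<beta>) (at 0)))"

definition exact_poisson ::
    "('m::{t2_space, second_countable_topology}, 'e::real_inner) chart set \<Rightarrow>
     'm bivec_field \<Rightarrow> bool"
  where "exact_poisson A \<pi> \<longleftrightarrow>
    (\<exists>D. smooth_vector_field A D \<and> has_lie_derivative A D \<pi> (\<lambda>p \<alpha> \<beta>. - \<pi> p \<alpha> \<beta>))"


section \<open>Smooth actions of the multiplicative group of positive reals\<close>

text \<open>The group is the open submanifold \<open>{0<..}\<close> of \<open>\<real>\<close>; \<open>\<Phi> s\<close> is irrelevant for \<open>s \<le> 0\<close>.\<close>

definition smooth_pos_action ::
    "('m::topological_space, 'e::real_inner) chart set \<Rightarrow> (real \<Rightarrow> 'm \<Rightarrow> 'm) \<Rightarrow> bool"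
  where "smooth_pos_action A \<Phi> \<longleftrightarrow>
    smooth_map_on (prod_atlas real_atlas A) A ({0<..} \<times> UNIV) (\<lambda>(s, x). \<Phi> s x) \<and>
    (\<forall>x. \<Phi> 1 x = x) \<and>
    (\<forall>r>0. \<forall>s>0. \<forall>x. \<Phi> (r * s) x = \<Phi> r (\<Phi> s x))"

end

theory Submission
  imports Defs
begin

text \<open>
  The flow \<open>\<phi>\<^sub>t = \<Phi>(exp (t / c), \<cdot>)\<close> is generated by a smooth vector field \<open>D\<close>, and the hypothesis at
  \<open>s = exp (- t / c)\<close> says that \<open>\<phi>\<^sub>t\<^sup>*\<Pi> = exp (- t) \<Pi>\<close>; differentiating at \<open>t = 0\<close> gives \<open>- \<Pi>\<close>.
\<close>

section \<open>Calculus of smooth functions\<close>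

text \<open>The Lie derivative may be computed with any one flow of the field, so the action itself
  supplies a flow defined for all times and no differential equation has to be solved. The sign
  comes from the inverse: pulling back along time \<open>t\<close> is pushing forward along time
  \<open>-t\<close>. The factor \<open>1 / c\<close> in the exponent cancels the weight
  \<open>c\<close> of the action. Most of the work lies in showing that \<open>D\<close>, obtained
  by differentiating functions along orbits, is a smooth field of derivations. Existence of each
  derivative would not give smooth dependence on the base point. Therefore f(\<phi>(t, x)) is
  treated as one function of time and point in the coordinates \<open>real \<times> 'e\<close>, and
  \<open>D\<close> becomes its partial derivative at time 0. This calls for a calculus of
  \<open>Ck_on\<close> on product spaces that includes composition.\<close>

lemma Ck_on_cong:
  assumes "open S" "\<And>x. x \<in> S \<Longrightarrow> f x = g x" "Ck_on k S f"
  shows "Ck_on k S g"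
  using assms(2,3)
proof (induction k arbitrary: f g)
  case 0
  then show ?case using continuous_on_cong[of S S f g] by simp
next
  case (Suc k)
  \<comment> \<open>Openness of \<open>S\<close> makes \<open>f\<close> and \<open>g\<close> agree
    on a whole neighbourhood of \<open>x\<close>, which a derivative taken in the full space
    requires.\<close>
  have d: "(g has_derivative frechet_derivative f (at x)) (at x)" if "x \<in> S" for x
  proof (rule has_derivative_transform_within_open[OF _ \<open>open S\<close> that Suc.prems(1)])
    show "(f has_derivative frechet_derivative f (at x)) (at x)"
      using Suc.prems(2) that by (simp add: frechet_derivative_works)
  qed
  have e: "frechet_derivative f (at x) = frechet_derivative g (at x)" if "x \<in> S" for x
    using d[OF that] by (rule frechet_derivative_at)
  have "Ck_on k S (\<lambda>x. frechet_derivative g (at x) v)" for v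
    by (rule Suc.IH[of "\<lambda>x. frechet_derivative f (at x) v"]) (use e Suc.prems(2) in auto)
  then show ?case using d by (auto simp: differentiable_def)
qed

lemma Ck_on_subset: "Ck_on k S f \<Longrightarrow> T \<subseteq> S \<Longrightarrow> Ck_on k T f"
  by (induction k arbitrary: f) (auto intro: continuous_on_subset)

lemma Ck_on_Suc_imp: "Ck_on (Suc k) S f \<Longrightarrow> Ck_on k S f"
proof (induction k arbitrary: f)
  case 0
  then show ?case
    by (auto intro!: continuous_at_imp_continuous_on differentiable_imp_continuous_within)
next
  case (Suc k)
  have "Ck_on k S (\<lambda>x. frechet_derivative f (at x) v)" for v
    by (rule Suc.IH) (use Suc.prems in \<open>simp only: Ck_on.simps, blast\<close>)
  then show ?case using Suc.prems by simp
qed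

text \<open>All derivatives are taken at points of the full space, so they are local by nature; only
  order 0 has content, where openness of \<open>T\<close> turns continuity on \<open>T\<close> into
  continuity at the point. It serves composites of manifold maps, where the intermediate chart
  varies from point to point.\<close>

lemma Ck_on_local:
  assumes "\<And>x. x \<in> S \<Longrightarrow> \<exists>T. open T \<and> x \<in> T \<and> Ck_on k T f"
  shows "Ck_on k S f"
  using assms
proof (induction k arbitrary: f)
  case 0
  show ?case
    unfolding Ck_on.simps
    by (metis "0" Ck_on.simps(1) continuous_at_imp_continuous_on continuous_on_eq_continuous_at)
next
  case (Suc k)
  have "Ck_on k S (\<lambda>x. frechet_derivative f (at x) v)" for v
    by (rule Suc.IH) (use Suc.prems in fastforce)
  then show ?case using Suc.prems by fastforce
qed

text \<open>Uniqueness of the derivative lets an explicit formula \<open>f'\<close> stand in for the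
  choice operator behind \<open>frechet_derivative\<close>. The inductive closure rules below rest
  on this.\<close>

lemma Ck_on_SucI:
  assumes "open S" "\<And>x. x \<in> S \<Longrightarrow> (f has_derivative f' x) (at x)"
    "\<And>v. Ck_on k S (\<lambda>x. f' x v)"
  shows "Ck_on (Suc k) S f"
proof -
  have "Ck_on k S (\<lambda>x. frechet_derivative f (at x) v)" for v
    by (rule Ck_on_cong[OF assms(1) _ assms(3)[of v]]) (metis assms(2) frechet_derivative_at)
  then show ?thesis using assms(2) by (auto simp: differentiable_def)
qed

lemma Ck_on_const:
  assumes "open S"
  shows "Ck_on k S (\<lambda>x. c)"
proof (induction k arbitrary: c)
  case (Suc k)
  show ?case by (rule Ck_on_SucI[OF assms, where f' = "\<lambda>x v. 0"]) (auto intro: Suc)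
qed simp

lemma Ck_on_linear:
  assumes "bounded_linear L" "open S"
  shows "Ck_on k S L"
proof (cases k)
  case 0
  then show ?thesis using assms by (simp add: linear_continuous_on)
next
  case (Suc k)
  show ?thesis unfolding Suc
    by (rule Ck_on_SucI[OF assms(2), where f' = "\<lambda>x. L"])
      (use assms in \<open>auto intro: bounded_linear_imp_has_derivative Ck_on_const\<close>)
qed

lemma Ck_on_derivative:
  assumes "Ck_on (Suc k) S f" "x \<in> S"
  shows "(f has_derivative frechet_derivative f (at x)) (at x)"
  using assms by (simp add: frechet_derivative_works)

lemma Ck_on_add:
  assumes "open S" "Ck_on k S f" "Ck_on k S g"
  shows "Ck_on k S (\<lambda>x. f x + g x)"
  using assms(2,3)
proof (induction k arbitrary: f g)
  case 0
  then show ?case by (simp add: continuous_on_add)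
next
  case (Suc k)
  show ?case
    by (rule Ck_on_SucI[OF assms(1)])
      (rule has_derivative_add[OF Ck_on_derivative[OF Suc.prems(1)] Ck_on_derivative[OF Suc.prems(2)]],
        assumption+, rule Suc.IH, use Suc.prems in auto)
qed

lemma Ck_on_sum:
  assumes "open S" "\<And>i. i \<in> I \<Longrightarrow> Ck_on k S (f i)"
  shows "Ck_on k S (\<lambda>x. \<Sum>i\<in>I. f i x)"
  using assms(2)
  by (induction I rule: infinite_finite_induct) (auto intro: Ck_on_add Ck_on_const assms(1))

text \<open>The product rule yields two terms of the same bilinear shape, so the induction closes
  when \<open>f\<close> and \<open>g\<close> are both arbitrary. One proof covers real products,
  scaling and inner products.\<close>

lemma Ck_on_bilinear:
  assumes "bounded_bilinear B" "open S" "Ck_on k S f" "Ck_on k S g"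
  shows "Ck_on k S (\<lambda>x. B (f x) (g x))"
  using assms(3,4)
proof (induction k arbitrary: f g)
  case 0
  then show ?case using bounded_bilinear.continuous_on[OF assms(1)] by simp
next
  case (Suc k)
  show ?case
  proof (rule Ck_on_SucI[OF assms(2)])
    show "((\<lambda>x. B (f x) (g x)) has_derivative
        (\<lambda>h. B (f x) (frechet_derivative g (at x) h) + B (frechet_derivative f (at x) h) (g x))) (at x)"
      if "x \<in> S" for x
      by (rule bounded_bilinear.FDERIV[OF assms(1)])
        (use Suc.prems that in \<open>auto intro: Ck_on_derivative\<close>)
    show "Ck_on k S (\<lambda>x. B (f x) (frechet_derivative g (at x) v) + B (frechet_derivative f (at x) v) (g x))"
      for v
      by (intro Ck_on_add[OF assms(2)] Suc.IH) (use Suc.prems Ck_on_Suc_imp in auto)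
  qed
qed

text \<open>The dimension clause of \<open>smooth_manifold\<close> as a predicate on types, so that
  it passes to \<open>real \<times> 'e\<close>; dimension 0 stays included.\<close>

definition finite_dim :: "'a::real_inner itself \<Rightarrow> bool"
  where "finite_dim _ \<longleftrightarrow> (\<exists>B::'a set. finite B \<and> span B = UNIV)"

text \<open>Orthogonalise a finite spanning set: the remainder of the expansion is orthogonal to the
  span, hence to itself. The vectors are not normalised, and a zero vector among them is harmless
  because division by 0 gives 0.\<close>

lemma finite_dim_expansion:
  assumes "finite_dim TYPE('a::real_inner)"
  obtains B :: "'a::real_inner set" where "\<forall>x. x = (\<Sum>b\<in>B. (x \<bullet> b / (b \<bullet> b)) *\<^sub>R b)"
proof -
  obtain B0 :: "'a set" where "finite B0" "span B0 = UNIV"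
    using assms by (auto simp: finite_dim_def)
  then obtain B :: "'a set" where B: "finite B" "span B = UNIV" "pairwise orthogonal B"
    using basis_orthogonal[of B0] by auto
  have "x = (\<Sum>b\<in>B. (x \<bullet> b / (b \<bullet> b)) *\<^sub>R b)" for x :: 'a
  proof -
    let ?y = "x - (\<Sum>b\<in>B. (x \<bullet> b / (b \<bullet> b)) *\<^sub>R b)"
    have "b \<bullet> ?y = 0" if "b \<in> B" for b
    proof -
      have "b \<bullet> ?y = b \<bullet> x - (\<Sum>b'\<in>B. if b' = b then x \<bullet> b else 0)"
        unfolding inner_diff_right inner_sum_right
        using B(3) that by (auto intro!: sum.cong simp: pairwise_def orthogonal_def)
      then show ?thesis using B(1) that by (simp add: inner_commute)
    qed
    then have "B \<subseteq> {z. z \<bullet> ?y = 0}" by blast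
    moreover have "subspace {z. z \<bullet> ?y = 0}" by (auto intro: subspaceI simp: inner_add_left)
    ultimately have "orthogonal z ?y" if "z \<in> span B" for z
      using that span_minimal by (auto simp: orthogonal_def)
    then have "orthogonal ?y ?y" using B(2) by blast
    then show ?thesis by (simp add: orthogonal_def)
  qed
  then show ?thesis by (intro that allI)
qed

lemma finite_dim_real: "finite_dim TYPE(real)"
proof -
  have "x \<in> span {1}" for x :: real
    using span_scale[OF span_base[of 1 "{1::real}"], of x] by simp
  then show ?thesis unfolding finite_dim_def by (intro exI[of _ "{1}"]) auto
qed

text \<open>Coordinate expressions of the flow live on \<open>real \<times> 'e\<close>, which is the
  middle space of the compositions made later.\<close>

lemma finite_dim_prod:
  assumes "finite_dim TYPE('a::real_inner)" "finite_dim TYPE('b::real_inner)"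
  shows "finite_dim TYPE('a::real_inner \<times> 'b::real_inner)"
proof -
  obtain B :: "'a set" and C :: "'b set"
    where B: "finite B" "span B = UNIV" and C: "finite C" "span C = UNIV"
    using assms by (auto simp: finite_dim_def)
  let ?i = "\<lambda>x::'a. (x, 0::'b)" and ?j = "\<lambda>y::'b. (0::'a, y)"
  have "linear ?i" "linear ?j" by (auto intro!: linearI)
  then have *: "range ?i = span (?i ` B)" "range ?j = span (?j ` C)"
    using linear_span_image B(2) C(2) by metis+
  have "(x, y) \<in> span (?i ` B \<union> ?j ` C)" for x y
  proof -
    have "(x, 0) \<in> span (?i ` B \<union> ?j ` C)" "(0, y) \<in> span (?i ` B \<union> ?j ` C)"
      using * span_mono[of "?i ` B" "?i ` B \<union> ?j ` C"] span_mono[of "?j ` C" "?i ` B \<union> ?j ` C"] by auto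
    then show ?thesis using span_add by fastforce
  qed
  then show ?thesis using B(1) C(1) unfolding finite_dim_def
    by (intro exI[of _ "?i ` B \<union> ?j ` C"]) auto
qed

text \<open>Finite dimension of the middle space is needed to turn \<open>x \<mapsto> Dg(h x)(Dh(x) v)\<close> into a finite
  sum of products of functions of class \<open>C\<^sup>k\<close>, since \<open>Ck_on\<close> only speaks of directional derivatives.\<close>

lemma Ck_on_compose:
  fixes h :: "'a::real_normed_vector \<Rightarrow> 'b::real_inner" and g :: "'b \<Rightarrow> 'c::real_normed_vector"
  assumes "finite_dim TYPE('b)" "open S" "h ` S \<subseteq> T" "Ck_on k S h" "Ck_on k T g"
  shows "Ck_on k S (\<lambda>x. g (h x))"
  using assms(4,5)
proof (induction k arbitrary: g)
  case 0
  then show ?case using assms(3) continuous_on_compose2[of T g S h] by simp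
next
  case (Suc k)
  obtain B :: "'b set" where B: "\<forall>x. x = (\<Sum>b\<in>B. (x \<bullet> b / (b \<bullet> b)) *\<^sub>R b)"
    by (rule finite_dim_expansion[OF assms(1)])
  let ?h = "\<lambda>x. frechet_derivative h (at x)" and ?g = "\<lambda>y. frechet_derivative g (at y)"
  have dh: "(h has_derivative ?h x) (at x)" and dg: "(g has_derivative ?g (h x)) (at (h x))"
    if "x \<in> S" for x
    using Ck_on_derivative[OF Suc.prems(1) that] Ck_on_derivative[OF Suc.prems(2)] that assms(3)
    by blast+
  show ?case
  proof (rule Ck_on_SucI[OF assms(2)])
    show "((\<lambda>x. g (h x)) has_derivative
        (\<lambda>v. \<Sum>b\<in>B. (?h x v \<bullet> b / (b \<bullet> b)) *\<^sub>R ?g (h x) b)) (at x)" if "x \<in> S" for x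
    proof -
      have lin: "linear (?g (h x))" using dg[OF that] has_derivative_linear by blast
      have "((\<lambda>x. g (h x)) has_derivative (\<lambda>v. ?g (h x) (?h x v))) (at x)"
        using has_derivative_compose[OF dh[OF that] dg[OF that]] .
      moreover have "?g (h x) (?h x v) = (\<Sum>b\<in>B. (?h x v \<bullet> b / (b \<bullet> b)) *\<^sub>R ?g (h x) b)" for v
        using arg_cong[OF spec[OF B, of "?h x v"], of "?g (h x)"]
        by (simp only: linear_sum[OF lin] linear_scale[OF lin])
      ultimately show ?thesis by (simp only:)
    qed
    show "Ck_on k S (\<lambda>x. \<Sum>b\<in>B. (?h x v \<bullet> b / (b \<bullet> b)) *\<^sub>R ?g (h x) b)" for v
    proof (intro Ck_on_sum[OF assms(2)] Ck_on_bilinear[OF bounded_bilinear_scaleR assms(2)])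
      fix b assume "b \<in> B"
      have "Ck_on k S (\<lambda>x. ?h x v \<bullet> ((1 / (b \<bullet> b)) *\<^sub>R b))"
        by (rule Ck_on_bilinear[OF bounded_bilinear_inner assms(2)])
          (use Suc.prems(1) Ck_on_const[OF assms(2)] in simp_all)
      then show "Ck_on k S (\<lambda>x. ?h x v \<bullet> b / (b \<bullet> b))" by simp
      show "Ck_on k S (\<lambda>x. ?g (h x) b)"
        by (rule Suc.IH[OF Ck_on_Suc_imp[OF Suc.prems(1)], of "\<lambda>y. ?g y b"])
          (use Suc.prems(2) in simp)
    qed
  qed
qed

lemma Ck_on_exp:
  assumes "open (S :: real set)"
  shows "Ck_on k S exp"
proof (induction k)
  case 0
  then show ?case by (simp add: continuous_on_exp)
next
  case (Suc k)
  show ?case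
  proof (rule Ck_on_SucI[OF assms])
    show "(exp has_derivative (\<lambda>v. v * exp x)) (at x)" for x :: real
      using DERIV_exp[of x] by (simp add: has_field_derivative_def mult_commute_abs)
    show "Ck_on k S (\<lambda>x. v * exp x)" for v
      by (rule Ck_on_bilinear[OF bounded_bilinear_mult assms Ck_on_const[OF assms] Suc.IH])
  qed
qed

section \<open>Smoothness of all orders: composition, restriction and locality\<close>

lemma smooth_on_compose:
  fixes h :: "'a::real_normed_vector \<Rightarrow> 'b::real_inner"
  assumes "finite_dim TYPE('b)" "open S" "h ` S \<subseteq> T" "\<And>k. Ck_on k S h" "smooth_on T g"
  shows "smooth_on S (\<lambda>x. g (h x))"
  using assms unfolding smooth_on_def by (blast intro: Ck_on_compose)

lemma smooth_on_cong:
  assumes "smooth_on S f" "\<And>x. x \<in> S \<Longrightarrow> f x = g x"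
  shows "smooth_on S g"
  using assms unfolding smooth_on_def by (blast intro: Ck_on_cong)

lemma smooth_on_subset: "smooth_on S f \<Longrightarrow> open T \<Longrightarrow> T \<subseteq> S \<Longrightarrow> smooth_on T f"
  unfolding smooth_on_def by (blast intro: Ck_on_subset)

lemma smooth_on_local:
  assumes "open S" "\<And>x. x \<in> S \<Longrightarrow> \<exists>T. x \<in> T \<and> smooth_on T f"
  shows "smooth_on S f"
  using assms unfolding smooth_on_def by (meson Ck_on_local)

lemma smooth_on_frechet_derivative:
  assumes "smooth_on S f"
  shows "smooth_on S (\<lambda>x. frechet_derivative f (at x) v)"
  using assms unfolding smooth_on_def by (metis Ck_on.simps(2))

section \<open>Smooth maps between manifolds\<close>

lemma is_chart_inv: "is_chart (U, \<kappa>) \<Longrightarrow> x \<in> U \<Longrightarrow> inv_into U \<kappa> (\<kappa> x) = x"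
  by (auto simp: is_chart_def homeomorphism_def)

lemma is_chart_open_image:
  assumes "is_chart (U, \<kappa>)" "open V" "V \<subseteq> U"
  shows "open (\<kappa> ` V)"
proof -
  have "openin (top_of_set (\<kappa> ` U)) (\<kappa> ` V)"
    using assms by (intro homeomorphism_imp_open_map) (auto simp: is_chart_def openin_open_eq)
  then show ?thesis using assms(1) by (auto simp: is_chart_def openin_open_eq)
qed

text \<open>\<open>inv_into\<close> chooses preimages, so injectivity is what splits the inverse of
  the product coordinates into its components. The splitting gives continuity of the inverse here
  and evaluates the coordinate expressions of the flow later.\<close>

lemma is_chart_real_prod:
  assumes "is_chart (U, \<kappa>)"
  shows "is_chart (UNIV \<times> U, map_prod (\<lambda>t::real. t) \<kappa>)"
    and "y \<in> \<kappa> ` U \<Longrightarrow>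
      inv_into (UNIV \<times> U) (map_prod (\<lambda>t::real. t) \<kappa>) (t, y) = (t, inv_into U \<kappa> y)"
proof -
  let ?k = "map_prod (\<lambda>t::real. t) \<kappa>" and ?i = "\<lambda>(t::real, y). (t, inv_into U \<kappa> y)"
  have o: "open U" "open (\<kappa> ` U)" and c: "continuous_on U \<kappa>" "continuous_on (\<kappa> ` U) (inv_into U \<kappa>)"
    and j: "inj_on \<kappa> U"
    using assms by (auto simp: is_chart_def homeomorphism_def intro: inj_on_inverseI)
  have im: "?k ` (UNIV \<times> U) = UNIV \<times> \<kappa> ` U" by auto
  have inj: "inj_on ?k (UNIV \<times> U)" using j by (auto simp: inj_on_def)
  show inv: "inv_into (UNIV \<times> U) ?k (t, y) = (t, inv_into U \<kappa> y)" if "y \<in> \<kappa> ` U" for t y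
    by (rule inv_into_f_eq[OF inj]) (use that in \<open>auto intro: inv_into_into simp: f_inv_into_f\<close>)
  have "continuous_on (UNIV \<times> U) ?k"
    unfolding map_prod_def case_prod_beta
    by (intro continuous_intros continuous_on_compose2[OF c(1)]) auto
  moreover have "continuous_on (UNIV \<times> \<kappa> ` U) ?i"
    unfolding case_prod_beta
    by (intro continuous_intros continuous_on_compose2[OF c(2)]) auto
  then have "continuous_on (UNIV \<times> \<kappa> ` U) (inv_into (UNIV \<times> U) ?k)"
    by (rule continuous_on_cong[THEN iffD1, rotated -1]) (auto simp: inv)
  moreover have "inv_into (UNIV \<times> U) ?k ` (UNIV \<times> \<kappa> ` U) = UNIV \<times> U"
    using inv_into_image_cancel[OF inj subset_refl] unfolding im .
  ultimately show "is_chart (UNIV \<times> U, ?k)"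
    unfolding is_chart_def using o inj
    by (auto simp: im homeomorphism_def inv j intro!: open_Times)
qed

lemma smooth_map_onD:
  assumes "smooth_map_on A B W F" "(U, \<kappa>) \<in> A" "(V, \<eta>) \<in> B"
  shows "smooth_on (\<kappa> ` {x \<in> W \<inter> U. F x \<in> V}) (\<lambda>y. \<eta> (F (inv_into U \<kappa> y)))"
  using assms by (auto simp: smooth_map_on_def)

lemma smooth_map_on_subset:
  assumes "\<And>C. C \<in> A \<Longrightarrow> is_chart C" "\<And>C. C \<in> B \<Longrightarrow> is_chart C"
    "smooth_map_on A B W F" "open V" "V \<subseteq> W"
  shows "smooth_map_on A B V F"
proof -
  have cV: "continuous_on V F" using assms by (auto simp: smooth_map_on_def intro: continuous_on_subset)
  have "smooth_on (\<kappa> ` {x \<in> V \<inter> U. F x \<in> Z}) (\<lambda>y. \<zeta> (F (inv_into U \<kappa> y)))"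
    if "(U, \<kappa>) \<in> A" "(Z, \<zeta>) \<in> B" for U \<kappa> Z \<zeta>
  proof (rule smooth_on_subset)
    show "smooth_on (\<kappa> ` {x \<in> W \<inter> U. F x \<in> Z}) (\<lambda>y. \<zeta> (F (inv_into U \<kappa> y)))"
      by (rule smooth_map_onD[OF assms(3) that])
    have ch: "is_chart (U, \<kappa>)" "is_chart (Z, \<zeta>)" using assms(1,2) that by auto
    then have "open (V \<inter> F -` Z)" and "open U"
      using continuous_open_preimage[OF cV assms(4)] by (auto simp: is_chart_def)
    moreover have "{x \<in> V \<inter> U. F x \<in> Z} = (V \<inter> F -` Z) \<inter> U" by auto
    ultimately have "open {x \<in> V \<inter> U. F x \<in> Z}" by (simp only: open_Int)
    then show "open (\<kappa> ` {x \<in> V \<inter> U. F x \<in> Z})" by (rule is_chart_open_image[OF ch(1)]) auto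
  qed (use assms(5) in auto)
  then show ?thesis using cV assms(4) by (auto simp: smooth_map_on_def)
qed

text \<open>Smoothness is local, so near each point a chart of \<open>B\<close> around the image
  under \<open>F\<close> can be inserted; there the coordinate expression of the composite is that
  of \<open>G\<close> after that of \<open>F\<close>. No single middle chart need work on the whole
  domain.\<close>

lemma smooth_map_on_compose:
  fixes A :: "('m::topological_space, 'e::real_inner) chart set"
    and B :: "('n::topological_space, 'f::real_inner) chart set"
    and C :: "('l::topological_space, 'g::real_inner) chart set"
  assumes chart: "\<And>c. c \<in> A \<Longrightarrow> is_chart c" "\<And>c. c \<in> B \<Longrightarrow> is_chart c" "\<And>c. c \<in> C \<Longrightarrow> is_chart c"
    and cover: "(\<Union>c\<in>B. fst c) = UNIV" and fd: "finite_dim TYPE('f)"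
    and F: "smooth_map_on A B V F" and G: "smooth_map_on B C W G" and FVW: "F ` V \<subseteq> W"
  shows "smooth_map_on A C V (\<lambda>x. G (F x))"
proof -
  have cF: "continuous_on V F" and oV: "open V" and cG: "continuous_on W G" and oW: "open W"
    using F G by (auto simp: smooth_map_on_def)
  have cGF: "continuous_on V (\<lambda>x. G (F x))" by (rule continuous_on_compose2[OF cG cF FVW])
  have "smooth_on (\<kappa> ` {x \<in> V \<inter> U. G (F x) \<in> Z}) (\<lambda>y. \<zeta> (G (F (inv_into U \<kappa> y))))"
    if c: "(U, \<kappa>) \<in> A" "(Z, \<zeta>) \<in> C" for U \<kappa> Z \<zeta>
  proof (rule smooth_on_local)
    have k: "is_chart (U, \<kappa>)" and "is_chart (Z, \<zeta>)" using chart c by auto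
    then have op: "open U" "open Z" by (auto simp: is_chart_def)
    have o: "open (U \<inter> (V \<inter> (\<lambda>x. G (F x)) -` Z))"
      using continuous_open_preimage[OF cGF oV op(2)] op(1) by auto
    have eq: "{x \<in> V \<inter> U. G (F x) \<in> Z} = U \<inter> (V \<inter> (\<lambda>x. G (F x)) -` Z)" by auto
    show "open (\<kappa> ` {x \<in> V \<inter> U. G (F x) \<in> Z})"
      unfolding eq by (rule is_chart_open_image[OF k o]) auto
    fix y assume "y \<in> \<kappa> ` {x \<in> V \<inter> U. G (F x) \<in> Z}"
    then obtain x where x: "x \<in> V" "x \<in> U" "G (F x) \<in> Z" "y = \<kappa> x" by auto
    obtain U' \<eta> where U': "(U', \<eta>) \<in> B" "F x \<in> U'" using cover by fastforce
    have n: "is_chart (U', \<eta>)" using chart U' by auto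
    define X where "X = {x \<in> V \<inter> U. F x \<in> U' \<and> G (F x) \<in> Z}"
    have "X = (U \<inter> (V \<inter> (\<lambda>x. G (F x)) -` Z)) \<inter> (V \<inter> F -` U')" by (auto simp: X_def)
    then have "open X"
      using continuous_open_preimage[OF cF oV, of U'] n o by (auto simp: is_chart_def)
    then have oX: "open (\<kappa> ` X)" by (rule is_chart_open_image[OF k]) (auto simp: X_def)
    have "smooth_on (\<kappa> ` X) (\<lambda>y. \<zeta> (G (inv_into U' \<eta> (\<eta> (F (inv_into U \<kappa> y))))))"
    proof (rule smooth_on_compose[OF fd oX])
      show "smooth_on (\<eta> ` {x \<in> W \<inter> U'. G x \<in> Z}) (\<lambda>z. \<zeta> (G (inv_into U' \<eta> z)))"
        by (rule smooth_map_onD[OF G U'(1) c(2)])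
      have "smooth_on (\<kappa> ` {x \<in> V \<inter> U. F x \<in> U'}) (\<lambda>y. \<eta> (F (inv_into U \<kappa> y)))"
        by (rule smooth_map_onD[OF F c(1) U'(1)])
      then have "smooth_on (\<kappa> ` X) (\<lambda>y. \<eta> (F (inv_into U \<kappa> y)))"
        by (rule smooth_on_subset[OF _ oX]) (auto simp: X_def)
      then show "Ck_on k (\<kappa> ` X) (\<lambda>y. \<eta> (F (inv_into U \<kappa> y)))" for k
        by (simp add: smooth_on_def)
      show "(\<lambda>y. \<eta> (F (inv_into U \<kappa> y))) ` \<kappa> ` X \<subseteq> \<eta> ` {x \<in> W \<inter> U'. G x \<in> Z}"
        using FVW by (auto simp: X_def is_chart_inv[OF k])
    qed
    then have "smooth_on (\<kappa> ` X) (\<lambda>y. \<zeta> (G (F (inv_into U \<kappa> y))))"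
      by (rule smooth_on_cong) (auto simp: X_def is_chart_inv[OF k] is_chart_inv[OF n])
    moreover have "y \<in> \<kappa> ` X" using x U' by (auto simp: X_def)
    ultimately show "\<exists>T. y \<in> T \<and> smooth_on T (\<lambda>y. \<zeta> (G (F (inv_into U \<kappa> y))))" by blast
  qed
  then show ?thesis using cGF oV by (auto simp: smooth_map_on_def)
qed

section \<open>Real-valued smooth functions and the algebra of germs at a point\<close>

lemma is_chart_real_atlas: "C \<in> real_atlas \<Longrightarrow> is_chart C"
  by (auto simp: real_atlas_def is_chart_def homeomorphism_def intro!: continuous_on_inv_into)

lemma smooth_fun_on_iff:
  "smooth_fun_on A W f \<longleftrightarrow> open W \<and> continuous_on W f \<and>
    (\<forall>(U, \<kappa>)\<in>A. smooth_on (\<kappa> ` (W \<inter> U)) (\<lambda>y. f (inv_into U \<kappa> y)))"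
  by (simp add: smooth_fun_on_def smooth_map_on_def real_atlas_def Int_def)

text \<open>Continuity comes from the coordinate expressions: on a chart domain, \<open>f\<close> is
  its coordinate expression after the chart map, and the charts cover the manifold.\<close>

lemma smooth_fun_onI:
  assumes "smooth_manifold A" "open W"
    and smooth: "\<And>U \<kappa>. (U, \<kappa>) \<in> A \<Longrightarrow> smooth_on (\<kappa> ` (W \<inter> U)) (\<lambda>y. f (inv_into U \<kappa> y))"
  shows "smooth_fun_on A W f"
proof -
  have "isCont f x" if "x \<in> W" for x
  proof -
    have "x \<in> (\<Union>C\<in>A. fst C)" using assms(1) by (simp add: smooth_manifold_def)
    then obtain U \<kappa> where c: "(U, \<kappa>) \<in> A" "x \<in> U" by fastforce
    then have k: "is_chart (U, \<kappa>)" using assms(1) by (auto simp: smooth_manifold_def)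
    then have "continuous_on (W \<inter> U) \<kappa>" "open U"
      by (auto simp: is_chart_def homeomorphism_def intro: continuous_on_subset)
    moreover have "Ck_on 0 (\<kappa> ` (W \<inter> U)) (\<lambda>y. f (inv_into U \<kappa> y))"
      using smooth[OF c(1)] unfolding smooth_on_def by blast
    ultimately have "continuous_on (W \<inter> U) (\<lambda>x. f (inv_into U \<kappa> (\<kappa> x)))"
      by (intro continuous_on_compose2[of "\<kappa> ` (W \<inter> U)" "\<lambda>y. f (inv_into U \<kappa> y)" _ \<kappa>]) auto
    then have "continuous_on (W \<inter> U) f"
      by (rule continuous_on_cong[THEN iffD1, rotated -1]) (auto simp: is_chart_inv[OF k])
    then show ?thesis
      using \<open>open U\<close> assms(2) c(2) that continuous_on_eq_continuous_at[of "W \<inter> U" f] by auto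
  qed
  then have "continuous_on W f" by (simp add: continuous_at_imp_continuous_on)
  then show ?thesis using assms(2) smooth by (auto simp: smooth_fun_on_iff)
qed

text \<open>Linear combinations and products of germs are handled together: both functions are
  restricted to a common neighbourhood, and closure under \<open>h\<close> is only asked for in
  coordinates.\<close>

lemma smooth_near_binop:
  fixes A :: "('m::{t2_space, second_countable_topology}, 'e::real_inner) chart set"
  assumes M: "smooth_manifold A" and "smooth_near A p f" "smooth_near A p g"
    and h: "\<And>(S :: 'e set) k u v. open S \<Longrightarrow> Ck_on k S u \<Longrightarrow> Ck_on k S v \<Longrightarrow> Ck_on k S (\<lambda>x. h (u x) (v x))"
  shows "smooth_near A p (\<lambda>x. h (f x) (g x))"
proof -
  obtain V W where p: "p \<in> V" "p \<in> W" and f: "smooth_fun_on A V f" and g: "smooth_fun_on A W g"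
    using assms(2,3) by (auto simp: smooth_near_def)
  have o: "open (V \<inter> W)" using f g by (auto simp: smooth_fun_on_iff)
  have "smooth_fun_on A (V \<inter> W) (\<lambda>x. h (f x) (g x))"
  proof (rule smooth_fun_onI[OF M o])
    fix U \<kappa> assume c: "(U, \<kappa>) \<in> A"
    then have k: "is_chart (U, \<kappa>)" using M by (auto simp: smooth_manifold_def)
    then have "open (V \<inter> W \<inter> U)" using o by (auto simp: is_chart_def)
    then have o': "open (\<kappa> ` (V \<inter> W \<inter> U))" by (rule is_chart_open_image[OF k]) auto
    have "smooth_on (\<kappa> ` (V \<inter> U)) (\<lambda>y. f (inv_into U \<kappa> y))"
      "smooth_on (\<kappa> ` (W \<inter> U)) (\<lambda>y. g (inv_into U \<kappa> y))"
      using f g c by (auto simp: smooth_fun_on_iff)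
    then have "smooth_on (\<kappa> ` (V \<inter> W \<inter> U)) (\<lambda>y. f (inv_into U \<kappa> y))"
      "smooth_on (\<kappa> ` (V \<inter> W \<inter> U)) (\<lambda>y. g (inv_into U \<kappa> y))"
      using o' by (auto elim!: smooth_on_subset)
    then show "smooth_on (\<kappa> ` (V \<inter> W \<inter> U)) (\<lambda>y. h (f (inv_into U \<kappa> y)) (g (inv_into U \<kappa> y)))"
      unfolding smooth_on_def
      using h[of _ _ "\<lambda>y. f (inv_into U \<kappa> y)" "\<lambda>y. g (inv_into U \<kappa> y)"] by blast
  qed
  then show ?thesis using p by (auto simp: smooth_near_def)
qed

lemma smooth_near_lincomb:
  assumes "smooth_manifold A" "smooth_near A p f" "smooth_near A p g"
  shows "smooth_near A p (\<lambda>x. a * f x + b * g x)"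
  by (rule smooth_near_binop[OF assms, of "\<lambda>u v. a * u + b * v"])
    (intro Ck_on_add Ck_on_bilinear[OF bounded_bilinear_mult] Ck_on_const)

lemma smooth_near_mult:
  assumes "smooth_manifold A" "smooth_near A p f" "smooth_near A p g"
  shows "smooth_near A p (\<lambda>x. f x * g x)"
  by (rule smooth_near_binop[OF assms]) (rule Ck_on_bilinear[OF bounded_bilinear_mult])

section \<open>The generator of a smooth flow\<close>

text \<open>A smooth action of the additive group of reals, that is, a flow complete in time. In
  additive form the neutral element is time 0, where the Lie derivative is taken.\<close>

locale smooth_flow =
  fixes A :: "('m::{t2_space, second_countable_topology}, 'e::real_inner) chart set"
    and \<phi> :: "real \<Rightarrow> 'm \<Rightarrow> 'm"
  assumes manifold: "smooth_manifold A"
    and smooth: "smooth_map_on (prod_atlas real_atlas A) A UNIV (\<lambda>(t, x). \<phi> t x)"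
    and zero: "\<phi> 0 x = x"
    and add: "\<phi> (s + t) x = \<phi> s (\<phi> t x)"
begin

lemma chart: "C \<in> A \<Longrightarrow> is_chart C"
  using manifold by (simp add: smooth_manifold_def)

lemma chart_at: obtains U \<kappa> where "(U, \<kappa>) \<in> A" "x \<in> U"
proof -
  have "x \<in> (\<Union>C\<in>A. fst C)" using manifold by (simp add: smooth_manifold_def)
  then show ?thesis using that by fastforce
qed

lemma finite_dim: "finite_dim TYPE('e)"
  using manifold by (simp add: smooth_manifold_def finite_dim_def)

lemma prod_chart: "C \<in> prod_atlas real_atlas A \<Longrightarrow> is_chart C"
  using is_chart_real_prod(1) chart by (auto simp: prod_atlas_def real_atlas_def)

lemma continuous_flow: "continuous_on UNIV (\<lambda>(t, x). \<phi> t x)"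
  using smooth by (simp add: smooth_map_on_def)

lemma continuous_orbit: "continuous_on UNIV (\<lambda>t. \<phi> t x)"
proof -
  have "continuous_on UNIV (\<lambda>t. (\<lambda>(t, x). \<phi> t x) (t, x))"
    by (rule continuous_on_compose2[OF continuous_flow]) (auto intro!: continuous_intros)
  then show ?thesis by simp
qed

text \<open>The pullback of \<open>f\<close> along the flow map in product coordinates.
  Differentiating along an orbit at time 0 becomes a partial derivative in direction
  \<open>(1, 0)\<close>.\<close>

definition flow_rep :: "('m \<Rightarrow> real) \<Rightarrow> ('m, 'e) chart \<Rightarrow> real \<times> 'e \<Rightarrow> real"
  where "flow_rep f = (\<lambda>(U, \<kappa>) (t, y). f (\<phi> t (inv_into U \<kappa> y)))"

text \<open>Smoothness of \<open>f\<close> is known on \<open>W\<close> only, so the pairs of time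
  and point are restricted to those that the flow carries into \<open>W\<close>. This is not a
  product set in general, but it contains the slice at time 0 over
  \<open>U \<inter> W\<close>.\<close>

definition flow_rep_domain :: "'m set \<Rightarrow> ('m, 'e) chart \<Rightarrow> (real \<times> 'e) set"
  where "flow_rep_domain W = (\<lambda>(U, \<kappa>). map_prod (\<lambda>t. t) \<kappa> ` {(t, x). x \<in> U \<and> \<phi> t x \<in> W})"

lemma flow_rep_domain_0: "x \<in> U \<Longrightarrow> x \<in> W \<Longrightarrow> (0, \<kappa> x) \<in> flow_rep_domain W (U, \<kappa>)"
  unfolding flow_rep_domain_def prod.case by (rule image_eqI[of _ _ "(0, x)"]) (simp_all add: zero)

lemma smooth_flow_rep:
  assumes f: "smooth_fun_on A W f" and c: "(U, \<kappa>) \<in> A"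
  shows "smooth_on (flow_rep_domain W (U, \<kappa>)) (flow_rep f (U, \<kappa>))"
proof -
  let ?\<phi> = "\<lambda>(t, x). \<phi> t x" and ?k = "map_prod (\<lambda>t::real. t) \<kappa>"
  define V where "V = ?\<phi> -` W"
  have "open W" using f by (simp add: smooth_fun_on_iff)
  then have "open V" using continuous_open_preimage[OF continuous_flow open_UNIV, of W]
    by (simp add: V_def)
  then have sV: "smooth_map_on (prod_atlas real_atlas A) A V ?\<phi>"
    using prod_chart chart by (intro smooth_map_on_subset[OF _ _ smooth _ subset_UNIV])
  have "smooth_map_on (prod_atlas real_atlas A) real_atlas V (\<lambda>z. f (?\<phi> z))"
  proof (rule smooth_map_on_compose[where B = A and W = W, OF _ _ _ _ finite_dim sV])
    show "(\<Union>C\<in>A. fst C) = UNIV" using manifold by (simp add: smooth_manifold_def)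
    show "smooth_map_on A real_atlas W f" using f by (simp add: smooth_fun_on_def)
    show "?\<phi> ` V \<subseteq> W" by (auto simp: V_def)
  qed (rule prod_chart chart is_chart_real_atlas; assumption)+
  moreover have "(UNIV \<times> U, ?k) \<in> prod_atlas real_atlas A"
    using c by (auto simp: prod_atlas_def real_atlas_def)
  ultimately have "smooth_on (?k ` (V \<inter> UNIV \<times> U)) (\<lambda>y. f (?\<phi> (inv_into (UNIV \<times> U) ?k y)))"
    unfolding smooth_fun_on_def[symmetric] smooth_fun_on_iff by blast
  moreover have "V \<inter> UNIV \<times> U = {(t, x). x \<in> U \<and> \<phi> t x \<in> W}" by (auto simp: V_def)
  then have eq: "?k ` (V \<inter> UNIV \<times> U) = flow_rep_domain W (U, \<kappa>)"
    by (simp only: flow_rep_domain_def prod.case)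
  ultimately have "smooth_on (flow_rep_domain W (U, \<kappa>)) (\<lambda>y. f (?\<phi> (inv_into (UNIV \<times> U) ?k y)))"
    by (simp only: eq)
  then show ?thesis
    by (rule smooth_on_cong)
      (auto simp: flow_rep_domain_def flow_rep_def is_chart_real_prod(2)[OF chart[OF c]])
qed

text \<open>The infinitesimal generator of the flow; the default 0 is the normalisation that
  \<open>tangent_space\<close> imposes on functions that are not smooth near the point.\<close>

definition generator :: "'m \<Rightarrow> 'm tvec"
  where "generator x = (\<lambda>f. if smooth_near A x f then deriv (\<lambda>t. f (\<phi> t x)) 0 else 0)"

text \<open>The chain rule along the curve \<open>t\<close> to \<open>(t, \<kappa> x)\<close>, whose
  velocity is \<open>(1, 0)\<close>. The formula yields both the existence of the derivative along
  the orbit and its smooth dependence on \<open>x\<close>.\<close>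

lemma flow_rep_derivative:
  assumes f: "smooth_fun_on A W f" and c: "(U, \<kappa>) \<in> A" and x: "x \<in> U" "x \<in> W"
  shows "((\<lambda>t. f (\<phi> t x)) has_real_derivative
    frechet_derivative (flow_rep f (U, \<kappa>)) (at (0, \<kappa> x)) (1, 0)) (at 0)"
proof -
  let ?F = "flow_rep f (U, \<kappa>)"
  have "(0, \<kappa> x) \<in> flow_rep_domain W (U, \<kappa>)"
    using x by (rule flow_rep_domain_0)
  moreover have "Ck_on (Suc 0) (flow_rep_domain W (U, \<kappa>)) ?F"
    using smooth_flow_rep[OF f c] unfolding smooth_on_def by blast
  ultimately have d: "(?F has_derivative frechet_derivative ?F (at (0, \<kappa> x))) (at (0, \<kappa> x))"
    by (rule Ck_on_derivative[rotated])
  have "((\<lambda>t. (t, \<kappa> x)) has_derivative (\<lambda>t. (t, 0))) (at (0::real))"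
    by (auto intro!: derivative_eq_intros)
  from has_derivative_compose[OF this d]
  have "((\<lambda>t. f (\<phi> t x)) has_derivative
      (\<lambda>t. frechet_derivative ?F (at (0, \<kappa> x)) (t, 0))) (at 0)"
    by (simp add: flow_rep_def is_chart_inv[OF chart[OF c] x(1)])
  moreover have "(\<lambda>t. frechet_derivative ?F (at (0, \<kappa> x)) (t, 0)) =
      (*) (frechet_derivative ?F (at (0, \<kappa> x)) (1, 0))"
  proof
    fix t
    show "frechet_derivative ?F (at (0, \<kappa> x)) (t, 0) =
        frechet_derivative ?F (at (0, \<kappa> x)) (1, 0) * t"
      using linear_scale[OF has_derivative_linear[OF d], of t "(1, 0)"] by (simp add: mult.commute)
  qed
  ultimately show ?thesis by (simp only: has_field_derivative_def)
qed

lemma generator_works: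
  assumes "smooth_near A x f"
  shows "((\<lambda>t. f (\<phi> t x)) has_real_derivative generator x f) (at 0)"
proof -
  obtain W where W: "x \<in> W" "smooth_fun_on A W f" using assms by (auto simp: smooth_near_def)
  obtain U \<kappa> where c: "(U, \<kappa>) \<in> A" "x \<in> U" by (rule chart_at)
  note d = flow_rep_derivative[OF W(2) c W(1)]
  then show ?thesis
    using DERIV_imp_deriv[OF d] assms by (simp add: generator_def)
qed

lemma generator_eqI:
  "smooth_near A x f \<Longrightarrow> ((\<lambda>t. f (\<phi> t x)) has_real_derivative d) (at 0) \<Longrightarrow> generator x f = d"
  by (rule DERIV_unique[OF generator_works])

text \<open>The group law moves time \<open>t\<close> on the orbit of \<open>x\<close> to time 0 on
  the orbit of \<open>\<phi> t x\<close>, where \<open>generator\<close> is defined.\<close>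

lemma generator_velocity: "has_velocity A (\<lambda>s. \<phi> s x) t (generator (\<phi> t x))"
  unfolding has_velocity_def
proof (intro allI impI)
  fix f assume "smooth_near A (\<phi> t x) f"
  from generator_works[OF this]
  have "((\<lambda>s. f (\<phi> (s + t) x)) has_real_derivative generator (\<phi> t x) f) (at 0)"
    by (simp add: add)
  then show "((\<lambda>s. f (\<phi> s x)) has_real_derivative generator (\<phi> t x) f) (at t)"
    using DERIV_shift[of "\<lambda>s. f (\<phi> s x)" _ 0 t] by simp
qed

lemma generator_tangent: "generator p \<in> tangent_space A p"
  unfolding tangent_space_def
proof (intro CollectI conjI allI impI)
  fix f g a b assume n: "smooth_near A p f" "smooth_near A p g"
  note d = generator_works[OF n(1)] generator_works[OF n(2)]
  show "generator p (\<lambda>x. a * f x + b * g x) = a * generator p f + b * generator p g"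
    by (rule generator_eqI[OF smooth_near_lincomb[OF manifold n]])
      (use d in \<open>auto intro!: derivative_eq_intros\<close>)
  show "generator p (\<lambda>x. f x * g x) = f p * generator p g + g p * generator p f"
    by (rule generator_eqI[OF smooth_near_mult[OF manifold n]])
      (use d in \<open>auto intro!: derivative_eq_intros simp: zero\<close>)
  assume "\<forall>\<^sub>F x in nhds p. f x = g x"
  \<comment> \<open>The orbit starts at \<open>p\<close> and is continuous, so for small times it
    stays where \<open>f\<close> and \<open>g\<close> agree; hence the derivative depends on the
    germ only.\<close>
  moreover have "((\<lambda>t. \<phi> t p) \<longlongrightarrow> p) (nhds 0)"
    using continuous_orbit[of p] by (simp add: continuous_on_eq_continuous_at continuous_at zero
      tendsto_at_iff_tendsto_nhds[symmetric])
      (metis UNIV_I tendsto_at_iff_tendsto_nhds zero)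
  ultimately have "\<forall>\<^sub>F t in nhds 0. f (\<phi> t p) = g (\<phi> t p)"
    by (rule eventually_compose_filterlim)
  from DERIV_cong_ev[OF refl this refl] d(2)
  show "generator p f = generator p g" by (intro generator_eqI[OF n(1)]) (simp only:)
qed (simp add: generator_def)

text \<open>In a chart, the derivative of \<open>f\<close> along \<open>generator\<close> is a
  partial derivative of the smooth function \<open>flow_rep\<close>, restricted to time 0 by the
  linear embedding \<open>Pair 0\<close>.\<close>

lemma generator_smooth: "smooth_vector_field A generator"
  unfolding smooth_vector_field_def
proof (intro conjI allI impI generator_tangent)
  fix W f assume f: "smooth_fun_on A W f"
  then have W: "open W" by (simp add: smooth_fun_on_iff)
  show "smooth_fun_on A W (\<lambda>p. generator p f)"
  proof (rule smooth_fun_onI[OF manifold W])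
    fix U \<kappa> assume c: "(U, \<kappa>) \<in> A"
    note k = chart[OF c]
    let ?S = "\<kappa> ` (W \<inter> U)" and ?F = "flow_rep f (U, \<kappa>)"
    have "open (W \<inter> U)" using W k by (auto simp: is_chart_def)
    then have o: "open ?S" by (rule is_chart_open_image[OF k]) auto
    have "smooth_on ?S (\<lambda>y. frechet_derivative ?F (at (0, y)) (1, 0))"
    proof (rule smooth_on_compose[OF finite_dim_prod[OF finite_dim_real finite_dim] o])
      show "smooth_on (flow_rep_domain W (U, \<kappa>)) (\<lambda>z. frechet_derivative ?F (at z) (1, 0))"
        by (rule smooth_on_frechet_derivative[OF smooth_flow_rep[OF f c]])
      show "Ck_on k ?S (Pair 0)" for k
        by (rule Ck_on_linear[OF _ o]) (intro bounded_linear_Pair bounded_linear_zero bounded_linear_ident)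
      show "Pair 0 ` ?S \<subseteq> flow_rep_domain W (U, \<kappa>)"
        using flow_rep_domain_0 by blast
    qed
    then show "smooth_on ?S (\<lambda>y. generator (inv_into U \<kappa> y) f)"
    proof (rule smooth_on_cong)
      fix y assume "y \<in> ?S"
      then obtain x where x: "x \<in> W" "x \<in> U" "y = \<kappa> x" by auto
      have "smooth_near A x f" using f x by (auto simp: smooth_near_def)
      from generator_eqI[OF this flow_rep_derivative[OF f c x(2,1)]] x
      show "frechet_derivative ?F (at (0, y)) (1, 0) = generator (inv_into U \<kappa> y) f"
        by (simp add: is_chart_inv[OF k])
    qed
  qed
qed

lemma generator_is_flow: "is_flow A generator UNIV \<phi>"
  unfolding is_flow_def using smooth zero generator_velocity by (auto simp: is_interval_def)

lemma flow_inverse: "\<phi> t (\<phi> (-t) x) = x" "\<phi> (-t) (\<phi> t x) = x"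
  using add[of t "-t" x] add[of "-t" t x] zero by simp_all

text \<open>\<open>pull_bivector\<close> is defined through the inverse map; identifying it as time
  \<open>-t\<close> turns pullback into a pushforward by the action.\<close>

lemma bij_flow: "bij (\<phi> t)" and inv_flow: "inv (\<phi> t) = \<phi> (-t)"
  using flow_inverse by (auto intro!: bijI' inv_equality) (metis flow_inverse)+

end

text \<open>The exponential turns addition of times into multiplication of group elements. The
  substitution leaves the point of the manifold fixed, so the same pair of charts serves before and
  after it, and smoothness reduces to one composition in coordinates.\<close>

lemma smooth_flow_of_pos_action:
  fixes A :: "('m::{t2_space, second_countable_topology}, 'e::real_inner) chart set"
  assumes M: "smooth_manifold A" and act: "smooth_pos_action A \<Phi>"
  shows "smooth_flow A (\<lambda>t. \<Phi> (exp (k * t)))"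
proof
  show "smooth_manifold A" by (rule M)
  show "\<Phi> (exp (k * 0)) x = x" for x using act by (simp add: smooth_pos_action_def)
  show "\<Phi> (exp (k * (s + t))) x = \<Phi> (exp (k * s)) (\<Phi> (exp (k * t)) x)" for s t x
    using act by (simp add: smooth_pos_action_def distrib_left exp_add)
  let ?P = "\<lambda>(s, x). \<Phi> s x" and ?\<phi> = "\<lambda>(t, x). \<Phi> (exp (k * t)) x"
  have S: "smooth_map_on (prod_atlas real_atlas A) A ({0<..} \<times> UNIV) ?P"
    using act by (simp add: smooth_pos_action_def)
  have chart: "is_chart C" if "C \<in> A" for C using M that by (simp add: smooth_manifold_def)
  have fd: "finite_dim TYPE('e)" using M by (simp add: smooth_manifold_def finite_dim_def)
  have "continuous_on UNIV (\<lambda>z. ?P (exp (k * fst z), snd z))"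
    by (rule continuous_on_compose2[of "{0<..} \<times> UNIV" ?P])
      (use S in \<open>auto simp: smooth_map_on_def intro!: continuous_intros\<close>)
  then have cont: "continuous_on UNIV ?\<phi>" by (simp add: case_prod_beta)
  have "smooth_on (map_prod (\<lambda>t. t) \<kappa> ` {z \<in> UNIV \<times> U. ?\<phi> z \<in> V})
      (\<lambda>y. \<eta> (?\<phi> (inv_into (UNIV \<times> U) (map_prod (\<lambda>t. t) \<kappa>) y)))"
    if c: "(U, \<kappa>) \<in> A" "(V, \<eta>) \<in> A" for U \<kappa> V \<eta>
  proof -
    let ?k = "map_prod (\<lambda>t::real. t) \<kappa>"
    let ?i = "inv_into (UNIV \<times> U) ?k"
    define S1 where "S1 = ?k ` {z \<in> UNIV \<times> U. ?\<phi> z \<in> V}"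
    define S2 where "S2 = ?k ` {z \<in> ({0<..} \<times> UNIV) \<inter> (UNIV \<times> U). ?P z \<in> V}"
    have k': "is_chart (U, \<kappa>)" and n: "is_chart (V, \<eta>)" using chart c by auto
    then have ops: "open U" "open V" by (auto simp: is_chart_def)
    have "open ((UNIV \<times> U) \<inter> ?\<phi> -` V)"
      using continuous_open_preimage[OF cont open_UNIV ops(2)] ops(1)
      by (intro open_Int open_Times) auto
    moreover have "{z \<in> UNIV \<times> U. ?\<phi> z \<in> V} = (UNIV \<times> U) \<inter> ?\<phi> -` V" by auto
    ultimately have o: "open S1"
      unfolding S1_def by (intro is_chart_open_image[OF is_chart_real_prod(1)[OF k']]) auto
    \<comment> \<open>This is the map sending \<open>(t, y)\<close> to
      \<open>(exp (k * t), y)\<close>, written as a scaled constant vector plus a linear map so that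
      the bilinear and linear closure rules apply.\<close>
    let ?h = "\<lambda>z::real \<times> 'e. exp (k * fst z) *\<^sub>R (1::real, 0) + (0, snd z)"
    have "smooth_on S1 (\<lambda>z. \<eta> (?P (?i (?h z))))"
    proof (rule smooth_on_compose[OF finite_dim_prod[OF finite_dim_real fd] o])
      show "smooth_on S2 (\<lambda>y. \<eta> (?P (?i y)))"
        unfolding S2_def
      proof (rule smooth_map_onD[OF S _ c(2)])
        show "(UNIV \<times> U, ?k) \<in> prod_atlas real_atlas A"
          using c(1) by (auto simp: prod_atlas_def real_atlas_def)
      qed
      \<comment> \<open>Positivity of the exponential keeps the new time coordinate in
        \<open>{0<..}\<close>, the only region where the action is known to be smooth.\<close>
      show "?h ` S1 \<subseteq> S2"
      proof
        fix w assume "w \<in> ?h ` S1"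
        then obtain v where v: "w = ?h v" "v \<in> S1" by (rule imageE)
        from v(2) obtain z where z: "v = ?k z" "z \<in> {z \<in> UNIV \<times> U. ?\<phi> z \<in> V}"
          unfolding S1_def by (rule imageE)
        obtain t x where "z = (t, x)" by (cases z)
        with v(1) z have "w = ?k (exp (k * t), x)" "x \<in> U" "\<Phi> (exp (k * t)) x \<in> V" by simp_all
        then show "w \<in> S2" unfolding S2_def by (intro image_eqI[of _ _ "(exp (k * t), x)"]) simp_all
      qed
      show "Ck_on j S1 ?h" for j
      proof (intro Ck_on_add[OF o] Ck_on_bilinear[OF bounded_bilinear_scaleR o] Ck_on_const[OF o])
        show "Ck_on j S1 (\<lambda>z. exp (k * fst z))"
          by (rule Ck_on_compose[OF finite_dim_real o subset_UNIV
                Ck_on_linear[OF bounded_linear_const_mult[OF bounded_linear_fst] o] Ck_on_exp[OF open_UNIV]])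
        show "Ck_on j S1 (\<lambda>z. (0, snd z))"
          by (rule Ck_on_linear[OF _ o]) (intro bounded_linear_Pair bounded_linear_zero bounded_linear_snd)
      qed
    qed
    then show ?thesis
      unfolding S1_def[symmetric]
    proof (rule smooth_on_cong)
      fix y assume "y \<in> S1"
      then obtain t x where "y = (t, \<kappa> x)" "x \<in> U" by (auto simp: S1_def)
      then show "\<eta> (?P (?i (?h y))) = \<eta> (?\<phi> (?i y))" by (simp add: is_chart_real_prod(2)[OF k'])
    qed
  qed
  then show "smooth_map_on (prod_atlas real_atlas A) A UNIV ?\<phi>"
    using cont by (auto simp: smooth_map_on_def prod_atlas_def real_atlas_def)
qed

theorem proposition2p8:
  fixes A :: "('m::{t2_space, second_countable_topology}, 'e::real_inner) chart set"
    and \<pi> :: "'m bivec_field"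
    and \<Phi> :: "real \<Rightarrow> 'm \<Rightarrow> 'm"
    and c :: real
  assumes "poisson_manifold A \<pi>"
    and "smooth_pos_action A \<Phi>"
    and "c \<noteq> 0"
    and "\<And>s y \<alpha> \<beta>. s > 0 \<Longrightarrow> \<alpha> \<in> cotangent_space A y \<Longrightarrow> \<beta> \<in> cotangent_space A y \<Longrightarrow>
           push_bivector A UNIV (\<Phi> s) \<pi> y \<alpha> \<beta> = s powr c * \<pi> y \<alpha> \<beta>"
  shows "exact_poisson A \<pi>"
proof -
  let ?\<phi> = "\<lambda>t. \<Phi> (exp (1 / c * t))"
  interpret smooth_flow A ?\<phi>
    using assms by (intro smooth_flow_of_pos_action) (auto simp: poisson_manifold_def)
  have pull: "pull_bivector A UNIV (?\<phi> t) \<pi> p \<alpha> \<beta> = exp (-t) * \<pi> p \<alpha> \<beta>"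
    if "\<alpha> \<in> cotangent_space A p" "\<beta> \<in> cotangent_space A p" for t p \<alpha> \<beta>
  proof -
    \<comment> \<open>The pullback is a pushforward from the image of the time \<open>t\<close> map;
      surjectivity makes this image \<open>UNIV\<close>, as in the scaling hypothesis.\<close>
    have "range (?\<phi> t) = UNIV" using bij_flow by (rule bij_is_surj)
    moreover have "exp (1 / c * - t) powr c = exp (-t)" using assms(3) by (simp add: powr_def)
    ultimately show ?thesis
      using assms(4)[OF exp_gt_zero that, of "1 / c * - t"]
      by (simp only: pull_bivector_def inv_flow)
  qed
  have "((\<lambda>t. pull_bivector A (flow_slice UNIV t) (?\<phi> t) \<pi> p \<alpha> \<beta>)
      has_real_derivative - \<pi> p \<alpha> \<beta>) (at 0)"
    if "\<alpha> \<in> cotangent_space A p" "\<beta> \<in> cotangent_space A p" for p \<alpha> \<beta>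
  proof -
    have "flow_slice UNIV t = (UNIV :: 'm set)" for t by (simp add: flow_slice_def)
    moreover have "((\<lambda>t. exp (-t) * \<pi> p \<alpha> \<beta>) has_real_derivative - \<pi> p \<alpha> \<beta>) (at 0)"
      by (auto intro!: derivative_eq_intros)
    ultimately show ?thesis by (simp only: pull[OF that])
  qed
  then show ?thesis
    unfolding exact_poisson_def has_lie_derivative_def
    using generator_smooth generator_is_flow by blast
qed

end
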